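(* Let $H$ be a real Hilbert space, let $L>0$, and let $M\colon H\to H$ be a monotone and $L$-Lipschitz continuous operator with $\operatorname{zer} M:=\{x\in H\mid M(x)=0\}\neq\emptyset$. Let $\theta\in\big(0,\frac1L\big)$, $\alpha,\beta>0$, and $$\varepsilon^k:=\frac{\alpha}{\theta(k+\beta)}\qquad\text{for all }k\ge0 .$$ Let $x^0\in H$ and let $(x^k)_{k\ge0}$, $(y^{k+1})_{k\ge0}$ be generated, for all $k\ge0$, by $$\begin{cases} y^{k+1}=x^k-\theta\varepsilon^k x^k-\theta M(x^k),\\ x^{k+1}=x^k-\theta\varepsilon^{k+1}x^{k+1}-\theta M(y^{k+1}).\end{cases}$$ Then $(x^k)_k$ converges strongly, as $k\to+\infty$, to the minimum norm element of $\operatorname{zer} M$, and: (1) if $\alpha>1$, then $\|M(x^k)\|=O(k^{-1})$ as $k\to+\infty$; (2) if $\alpha\le1$, then for any $\delta\in(0,1)$, $\|M(x^k)\|=O(k^{-\alpha(1-\delta)})$ as $k\to+\infty$.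
   Context: Superscripts $k$ on $x^k,y^k,\varepsilon^k$ are indices, not powers. $M$ monotone means $\langle M(x)-M(x'),x-x'\rangle\ge0$ for all $x,x'\in H$. $L$-Lipschitz means $\|M(x)-M(x')\|\le L\|x-x'\|$ for all $x,x'\in H$. The second update is explicit: $x^{k+1}=(1+\theta\varepsilon^{k+1})^{-1}\big(x^k-\theta M(y^{k+1})\big)$. *)

theory Defs
  imports "HOL-Analysis.Analysis" "HOL-Library.Landau_Symbols"
begin

definition monotone_operator :: "('a::real_inner \<Rightarrow> 'a) \<Rightarrow> bool"
  where "monotone_operator M \<longleftrightarrow> (\<forall>x x'. (M x - M x') \<bullet> (x - x') \<ge> 0)"

definition zer :: "('a::real_inner \<Rightarrow> 'a) \<Rightarrow> 'a set"
  where "zer M = {x. M x = 0}"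

definition is_min_norm_element :: "'a::real_inner set \<Rightarrow> 'a \<Rightarrow> bool"
  where "is_min_norm_element S p \<longleftrightarrow> p \<in> S \<and> (\<forall>z\<in>S. norm p \<le> norm z)"

text \<open>
  The following is meaningful only if such an element exists and is unique.
\<close>

definition min_norm_element :: "'a::real_inner set \<Rightarrow> 'a"
  where "min_norm_element S = (THE p. is_min_norm_element S p)"

end

theory Submission
  imports Defs
begin

text \<open>
  Put \<open>a\<^sub>k = \<theta> \<epsilon>\<^sub>k = \<alpha> / (k + \<beta>)\<close>, so that \<open>\<Sum> a\<^sub>k\<close> diverges while \<open>\<Sum> a\<^sub>k\<^sup>2\<close>
  converges, and \<open>a\<^sub>k - a\<^sub>k\<^sub>+\<^sub>1\<close> is of order \<open>a\<^sub>k\<^sup>2\<close>. The method is an extragradient step for the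
  Tikhonov regularized operator \<open>\<theta> M + a\<^sub>k I\<close>, and two one-step inequalities carry everything.

  The first (\<open>fejer_step\<close>) is the usual extragradient estimate for the distance to a zero \<open>p\<close>; the
  regularization contributes a pull \<open>2 a\<^sub>k\<^sub>+\<^sub>1 \<langle>x\<^sub>k\<^sub>+\<^sub>1, x\<^sub>k\<^sub>+\<^sub>1 - p\<rangle>\<close> towards the origin and
  an error of order \<open>a\<^sub>k\<^sup>2\<close>. It bounds the iterates.

  The second (\<open>residual_step\<close>) concerns the residual \<open>g\<^sub>k = a\<^sub>k x\<^sub>k + \<theta> M x\<^sub>k\<close>. Because the
  second half of the update is implicit in the regularization, the displacement
  \<open>h = x\<^sub>k - x\<^sub>k\<^sub>+\<^sub>1\<close> equals \<open>a\<^sub>k\<^sub>+\<^sub>1 x\<^sub>k\<^sub>+\<^sub>1 + \<theta> M y\<^sub>k\<^sub>+\<^sub>1\<close>, which differs from the next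
  residual only in the point where \<open>M\<close> is evaluated. Monotonicity between \<open>x\<^sub>k\<close> and
  \<open>x\<^sub>k\<^sub>+\<^sub>1\<close> then shows that the squared residual shrinks by a factor
  \<open>1 - 2 q a\<^sub>k\<^sub>+\<^sub>1\<close>, for any fixed \<open>q < 1\<close>, up to an error \<open>O(k\<^sup>-\<^sup>3)\<close> caused by the change of
  \<open>a\<^sub>k\<close>. A recursion lemma of Chung type (\<open>power_decay_of_recursion\<close>) turns this into
  \<open>\<parallel>g\<^sub>k\<parallel> = O(k\<^sup>-\<^sup>s)\<close> for every \<open>s < \<alpha>\<close> with \<open>s \<le> 1\<close>. As \<open>a\<^sub>k x\<^sub>k = O(1/k)\<close>, the same
  rate holds for \<open>M x\<^sub>k\<close>: take \<open>s = 1\<close> if \<open>\<alpha> > 1\<close>, and \<open>s = \<alpha> (1 - \<delta>)\<close> otherwise.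

  For the convergence of the iterates let \<open>p\<close> be the zero of least norm. The Fejer inequality is
  a recursion for \<open>\<parallel>x\<^sub>k - p\<parallel>\<^sup>2\<close> that forces it to \<open>0\<close> as soon as
  \<open>limsup \<langle>p, p - x\<^sub>k\<rangle> \<le> 0\<close>. Instead of weak compactness, the proof of the latter uses the
  central path \<open>M z\<^sub>n + z\<^sub>n / (n + 1) = 0\<close>: it converges strongly to \<open>p\<close>, and monotonicity
  between \<open>x\<^sub>k\<close> and \<open>z\<^sub>n\<close> gives
  \<open>\<langle>z\<^sub>n, z\<^sub>n - x\<^sub>k\<rangle> \<le> (n + 1) \<parallel>M x\<^sub>k\<parallel> \<parallel>x\<^sub>k - z\<^sub>n\<parallel>\<close>, whose right-hand side tends to
  \<open>0\<close> as \<open>k\<close> grows with \<open>n\<close> fixed. The central path also yields existence of \<open>p\<close>.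
\<close>

section \<open>The minimum norm zero as limit of the central path\<close>

text \<open>
  The forward step \<open>z - t (M z + \<mu> z)\<close> is a contraction for small \<open>t\<close>, since
  \<open>M + \<mu> I\<close> is strongly monotone with constant \<open>\<mu>\<close> and Lipschitz with constant \<open>K = L + \<mu>\<close>:
  its squared Lipschitz constant is at most \<open>1 - 2 t \<mu> + t\<^sup>2 K\<^sup>2\<close>, and \<open>t = \<mu> / K\<^sup>2\<close>
  minimizes this.
\<close>

lemma monotone_lipschitz_regularized_zero:
  fixes M :: "'a::{real_inner, complete_space} \<Rightarrow> 'a"
  assumes mono: "monotone_operator M" and lip: "L-lipschitz_on UNIV M" and "\<mu> > 0"
  shows "\<exists>z. M z + \<mu> *\<^sub>R z = 0"
proof -
  define K where "K = L + \<mu>"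
  define t where "t = \<mu> / K\<^sup>2"
  define T where "T z = z - t *\<^sub>R (M z + \<mu> *\<^sub>R z)" for z
  define c where "c = sqrt (1 - (\<mu> / K)\<^sup>2)"
  have L: "L \<ge> 0" using lip by (rule lipschitz_on_nonneg)
  have K: "K > 0" "\<mu> \<le> K" using L \<open>\<mu> > 0\<close> by (auto simp: K_def)
  have t: "t > 0" using K \<open>\<mu> > 0\<close> by (simp add: t_def)
  have ratio: "0 < (\<mu> / K)\<^sup>2" "(\<mu> / K)\<^sup>2 \<le> 1"
    using K \<open>\<mu> > 0\<close> by (auto simp: power_le_one)
  have c: "0 \<le> c" "c < 1" using ratio by (auto simp: c_def)
  have contr: "dist (T z) (T w) \<le> c * dist z w" for z w
  proof -
    define d where "d = z - w"
    define v where "v = M z - M w + \<mu> *\<^sub>R d"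
    have "norm v \<le> norm (M z - M w) + norm (\<mu> *\<^sub>R d)"
      unfolding v_def by (rule norm_triangle_ineq)
    also have "\<dots> \<le> L * norm d + \<mu> * norm d"
      using lipschitz_onD[OF lip, of z w] \<open>\<mu> > 0\<close> by (simp add: dist_norm d_def)
    finally have v: "norm v \<le> K * norm d" by (simp add: K_def algebra_simps)
    have vd: "v \<bullet> d \<ge> \<mu> * (norm d)\<^sup>2"
      using mono by (auto simp: monotone_operator_def v_def d_def inner_add_left power2_norm_eq_inner)
    have "T z - T w = d - t *\<^sub>R v"
      by (simp add: T_def d_def v_def algebra_simps)
    then have "(norm (T z - T w))\<^sup>2 = (norm d)\<^sup>2 - 2 * t * (v \<bullet> d) + t\<^sup>2 * (norm v)\<^sup>2"
      unfolding power2_norm_eq_inner by (simp add: inner_diff inner_commute power2_eq_square)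
    also have "\<dots> \<le> (norm d)\<^sup>2 - 2 * t * (\<mu> * (norm d)\<^sup>2) + t\<^sup>2 * (K * norm d)\<^sup>2"
      using vd v t by (intro add_mono diff_mono mult_left_mono power_mono) auto
    also have "\<dots> = (1 - (\<mu> / K)\<^sup>2) * (norm d)\<^sup>2"
    proof -
      have "t * K\<^sup>2 = \<mu>" using K by (simp add: t_def)
      then have "t\<^sup>2 * K\<^sup>2 = t * \<mu>" "(\<mu> / K)\<^sup>2 = t * \<mu>"
        by (simp_all add: t_def power2_eq_square)
      then show ?thesis by (simp add: power_mult_distrib algebra_simps)
    qed
    also have "\<dots> = (c * norm d)\<^sup>2"
      using ratio by (simp add: c_def power_mult_distrib)
    finally have "norm (T z - T w) \<le> c * norm d"
      by (rule power2_le_imp_le) (use c in simp)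
    then show ?thesis by (simp add: dist_norm d_def)
  qed
  have "\<exists>!z\<in>UNIV. T z = z"
    by (rule Banach_fix[OF complete_UNIV UNIV_not_empty c subset_UNIV contr])
  then obtain z where "T z = z" by blast
  then show ?thesis using t by (auto simp: T_def)
qed

text \<open>
  Monotonicity between two points of the path gives
  \<open>\<parallel>z\<^sub>n - z\<^sub>m\<parallel>\<^sup>2 \<le> \<parallel>z\<^sub>m\<parallel>\<^sup>2 - \<parallel>z\<^sub>n\<parallel>\<^sup>2\<close> for \<open>n \<le> m\<close>. The norms therefore increase, and they are
  bounded by the norm of any zero, so the path is Cauchy. Monotonicity between \<open>z\<^sub>n\<close> and a
  zero \<open>q\<close> gives \<open>\<langle>z\<^sub>n, z\<^sub>n - q\<rangle> \<le> 0\<close>, which passes to the limit.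
\<close>
lemma central_path_limit:
  fixes M :: "'a::{real_inner, complete_space} \<Rightarrow> 'a"
  assumes mono: "monotone_operator M" and lip: "L-lipschitz_on UNIV M" and "zer M \<noteq> {}"
  obtains z p where "\<And>n. M (z n) = - (1 / real (Suc n)) *\<^sub>R z n" "z \<longlonglongrightarrow> p"
    "p \<in> zer M" "\<And>q. q \<in> zer M \<Longrightarrow> p \<bullet> (p - q) \<le> 0"
proof -
  have "\<exists>z. M z + (1 / real (Suc n)) *\<^sub>R z = 0" for n
    by (rule monotone_lipschitz_regularized_zero[OF mono lip]) simp
  then obtain z where "M (z n) + (1 / real (Suc n)) *\<^sub>R z n = 0" for n by metis
  then have z: "M (z n) = - (1 / real (Suc n)) *\<^sub>R z n" for n
    by (metis add_eq_0_iff2 scaleR_minus_left)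
  have zq: "z n \<bullet> (z n - q) \<le> 0" if "q \<in> zer M" for n q
  proof -
    have "0 \<le> (M (z n) - M q) \<bullet> (z n - q)" using mono by (simp add: monotone_operator_def)
    also have "\<dots> = - (1 / real (Suc n)) * (z n \<bullet> (z n - q))"
      using that by (simp add: z zer_def)
    finally show ?thesis by (simp add: field_simps del: of_nat_Suc)
  qed
  obtain q where q: "q \<in> zer M" using assms(3) by auto
  have bound: "norm (z n) \<le> norm q" for n
  proof -
    have "(norm (z n))\<^sup>2 \<le> z n \<bullet> q"
      using zq[OF q, of n] by (simp add: inner_diff power2_norm_eq_inner)
    also have "\<dots> \<le> norm (z n) * norm q" by (rule norm_cauchy_schwarz)
    finally show ?thesis by (cases "z n = 0") (auto simp: power2_eq_square)
  qed
  have step: "(norm (z n - z m))\<^sup>2 \<le> (norm (z m))\<^sup>2 - (norm (z n))\<^sup>2" if "n \<le> m" for n m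
  proof (cases "n = m")
    case False
    define l where "l = 1 / real (Suc n)"
    define r where "r = 1 / real (Suc m)"
    have lr: "0 < r" "r < l" using that False by (auto simp: l_def r_def field_simps)
    have "0 \<le> (M (z n) - M (z m)) \<bullet> (z n - z m)" using mono by (simp add: monotone_operator_def)
    also have "\<dots> = - ((l - r) * (z n \<bullet> (z n - z m))) - r * (norm (z n - z m))\<^sup>2"
      unfolding z l_def[symmetric] r_def[symmetric] power2_norm_eq_inner
      by (simp add: inner_diff inner_commute algebra_simps)
    finally have "(l - r) * (z n \<bullet> (z n - z m)) \<le> - (r * (norm (z n - z m))\<^sup>2)" by simp
    also have "\<dots> \<le> 0" using lr by simp
    finally have "z n \<bullet> (z n - z m) \<le> 0" using lr by (simp add: mult_le_0_iff)
    then show ?thesis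
      unfolding power2_norm_eq_inner by (simp add: inner_diff inner_commute algebra_simps)
  qed simp
  have inc: "incseq (\<lambda>n. (norm (z n))\<^sup>2)"
    unfolding incseq_def using step by (smt (verit) zero_le_power2)
  have "bdd_above (range (\<lambda>n. (norm (z n))\<^sup>2))"
    using bound by (intro bdd_aboveI2[where M="(norm q)\<^sup>2"] power_mono) auto
  then have "convergent (\<lambda>n. (norm (z n))\<^sup>2)"
    using LIMSEQ_incseq_SUP[OF _ inc] by (auto simp: convergent_def)
  then have cauchy: "Cauchy (\<lambda>n. (norm (z n))\<^sup>2)" by (rule convergent_Cauchy)
  have "Cauchy z"
  proof (rule metric_CauchyI)
    fix e :: real assume e: "e > 0"
    then obtain N where N: "\<And>m n. m \<ge> N \<Longrightarrow> n \<ge> N \<Longrightarrow> dist ((norm (z m))\<^sup>2) ((norm (z n))\<^sup>2) < e\<^sup>2"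
      using metric_CauchyD[OF cauchy, of "e\<^sup>2"] by auto
    have le: "dist (z n) (z m) < e" if "n \<ge> N" "n \<le> m" for m n
    proof -
      have "(norm (z n - z m))\<^sup>2 < e\<^sup>2"
        using step[OF that(2)] N[of m n] that by (auto simp: dist_real_def)
      then show ?thesis using e by (simp add: dist_norm power_less_imp_less_base)
    qed
    show "\<exists>N. \<forall>m\<ge>N. \<forall>n\<ge>N. dist (z m) (z n) < e"
      by (metis le dist_commute nat_le_linear)
  qed
  then obtain p where p: "z \<longlonglongrightarrow> p" using Cauchy_convergent_iff convergent_def by blast
  have cont: "isCont M p"
    using lipschitz_on_continuous_on[OF lip] by (simp add: continuous_on_eq_continuous_at)
  have "(\<lambda>n. M (z n)) \<longlonglongrightarrow> M p" by (rule isCont_tendsto_compose[OF cont p])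
  moreover have "(\<lambda>n. - (1 / real (Suc n)) *\<^sub>R z n) \<longlonglongrightarrow> - 0 *\<^sub>R p"
    by (intro tendsto_intros p LIMSEQ_Suc[OF lim_1_over_n])
  ultimately have "M p = 0" using LIMSEQ_unique by (fastforce simp: z)
  moreover have "p \<bullet> (p - q) \<le> 0" if "q \<in> zer M" for q
  proof (rule LIMSEQ_le_const2)
    show "(\<lambda>n. z n \<bullet> (z n - q)) \<longlonglongrightarrow> p \<bullet> (p - q)" by (intro tendsto_intros p)
  qed (use zq[OF that] in auto)
  ultimately show ?thesis using that[OF z p] by (simp add: zer_def)
qed

text \<open>
  The variational inequality improves \<open>\<parallel>p\<parallel> \<le> \<parallel>q\<parallel>\<close> to
  \<open>\<parallel>p\<parallel>\<^sup>2 + \<parallel>q - p\<parallel>\<^sup>2 \<le> \<parallel>q\<parallel>\<^sup>2\<close>, from which uniqueness is immediate.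
\<close>
lemma is_min_norm_elementI_variational:
  assumes "p \<in> S" and "\<And>q. q \<in> S \<Longrightarrow> p \<bullet> (p - q) \<le> 0"
  shows "is_min_norm_element S p" "is_min_norm_element S q \<Longrightarrow> q = p"
proof -
  have key: "(norm p)\<^sup>2 + (norm (q - p))\<^sup>2 \<le> (norm q)\<^sup>2" if "q \<in> S" for q
    using assms(2)[OF that] unfolding power2_norm_eq_inner
    by (simp add: inner_diff inner_commute algebra_simps)
  show "is_min_norm_element S p"
    unfolding is_min_norm_element_def
    using assms(1) key by (smt (verit) norm_ge_zero power2_le_imp_le zero_le_power2)
  assume q: "is_min_norm_element S q"
  then have "(norm q)\<^sup>2 \<le> (norm p)\<^sup>2" "q \<in> S"
    using assms(1) by (auto simp: is_min_norm_element_def intro: power_mono)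
  with key[of q] have "(norm (q - p))\<^sup>2 \<le> 0" by linarith
  then show "q = p" by simp
qed

lemma central_path_inner_le:
  assumes mono: "monotone_operator M" and z: "M z = - \<mu> *\<^sub>R z" and "\<mu> > 0"
  shows "z \<bullet> (z - x) \<le> norm (M x) * norm (x - z) / \<mu>"
proof -
  have "0 \<le> (M x - M z) \<bullet> (x - z)" using mono by (simp add: monotone_operator_def)
  then have "\<mu> * (z \<bullet> (z - x)) \<le> M x \<bullet> (x - z)"
    by (simp add: z inner_diff inner_add inner_commute algebra_simps)
  also have "\<dots> \<le> norm (M x) * norm (x - z)" by (rule norm_cauchy_schwarz)
  finally show ?thesis using \<open>\<mu> > 0\<close> by (simp add: field_simps)
qed

text \<open>
  This replaces the argument that weak cluster points of \<open>x\<close> are zeros of \<open>M\<close>. First a point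
  \<open>z\<^sub>n\<close> close enough to \<open>p\<close> is fixed, which costs at most \<open>\<eta> / 2\<close> uniformly in \<open>k\<close> by
  boundedness of \<open>x\<close>; for this \<open>n\<close>, \<open>central_path_inner_le\<close> bounds the rest for large \<open>k\<close>.
\<close>
lemma min_norm_limsup_inner:
  fixes M :: "'a::{real_inner, complete_space} \<Rightarrow> 'a"
  assumes mono: "monotone_operator M"
    and z: "\<And>n. M (z n) = - (1 / real (Suc n)) *\<^sub>R z n" "z \<longlonglongrightarrow> p"
    and x: "\<forall>\<^sub>F k in sequentially. norm (x k) \<le> B" and Mx: "(\<lambda>k. M (x k)) \<longlonglongrightarrow> 0" and "\<eta> > 0"
  shows "\<forall>\<^sub>F k in sequentially. p \<bullet> (p - x k) < \<eta>"
proof -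
  define f where "f n = norm (p - z n) * (norm p + \<bar>B\<bar>) + norm (z n) * norm (p - z n)" for n
  have "f \<longlonglongrightarrow> norm (p - p) * (norm p + \<bar>B\<bar>) + norm p * norm (p - p)"
    unfolding f_def by (intro tendsto_intros z)
  then have "\<forall>\<^sub>F n in sequentially. f n < \<eta> / 2"
    by (rule order_tendstoD(2)) (use \<open>\<eta> > 0\<close> in simp)
  then obtain n where n: "f n < \<eta> / 2" by (auto simp: eventually_sequentially)
  have "(\<lambda>k. norm (M (x k)) * (\<bar>B\<bar> + norm (z n)) / (1 / real (Suc n)))
      \<longlonglongrightarrow> norm (0::'a) * (\<bar>B\<bar> + norm (z n)) / (1 / real (Suc n))"
    by (intro tendsto_intros Mx) auto
  then have "\<forall>\<^sub>F k in sequentially. norm (M (x k)) * (\<bar>B\<bar> + norm (z n)) / (1 / real (Suc n)) < \<eta> / 2"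
    by (rule order_tendstoD(2)) (use \<open>\<eta> > 0\<close> in simp)
  then show ?thesis using x
  proof eventually_elim
    case (elim k)
    have xk: "norm (x k) \<le> \<bar>B\<bar>" using elim by simp
    have "z n \<bullet> (z n - x k) \<le> norm (M (x k)) * norm (x k - z n) / (1 / real (Suc n))"
      by (rule central_path_inner_le[OF mono z(1)]) simp
    also have "\<dots> \<le> norm (M (x k)) * (\<bar>B\<bar> + norm (z n)) / (1 / real (Suc n))"
      using xk norm_triangle_ineq4[of "x k" "z n"]
      by (intro divide_right_mono mult_left_mono) auto
    finally have 1: "z n \<bullet> (z n - x k) < \<eta> / 2" using elim by simp
    have "(p - z n) \<bullet> (p - x k) \<le> norm (p - z n) * norm (p - x k)" by (rule norm_cauchy_schwarz)
    also have "\<dots> \<le> norm (p - z n) * (norm p + \<bar>B\<bar>)"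
      using xk norm_triangle_ineq4[of p "x k"] by (intro mult_left_mono) auto
    finally have 2: "(p - z n) \<bullet> (p - x k) \<le> norm (p - z n) * (norm p + \<bar>B\<bar>)" .
    have 3: "z n \<bullet> (p - z n) \<le> norm (z n) * norm (p - z n)" by (rule norm_cauchy_schwarz)
    have "p \<bullet> (p - x k) = (p - z n) \<bullet> (p - x k) + z n \<bullet> (p - z n) + z n \<bullet> (z n - x k)"
      by (simp add: inner_diff inner_commute)
    then show ?case using 1 2 3 n by (simp add: f_def)
  qed
qed

section \<open>A recursion lemma of Chung type\<close>

text \<open>
  For \<open>w\<^sub>k = k\<^sup>s u\<^sub>k\<close> and \<open>d = c - s\<close> the recursion becomes
  \<open>(1 + d/k) w\<^sub>k\<^sub>+\<^sub>1 \<le> w\<^sub>k + C'/k\<close>, because \<open>(1 + 1/k)\<^sup>s (1 - c/k) \<le> exp (- d/k)\<close> and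
  \<open>s \<le> 2\<close> makes the perturbation \<open>O(1/k)\<close>. Any bound \<open>R \<ge> C'/d\<close> on \<open>w\<close> is then preserved.
\<close>
lemma power_decay_of_recursion:
  fixes u :: "nat \<Rightarrow> real"
  assumes nn: "\<And>k. u k \<ge> 0" and s: "0 < s" "s < c" "s \<le> 2"
    and rec: "\<forall>\<^sub>F k in sequentially. u (Suc k) \<le> (1 - c / real k) * u k + C / real k ^ 3"
  shows "u \<in> O(\<lambda>k. real k powr (- s))"
proof -
  define d where "d = c - s"
  define C' where "C' = 4 * \<bar>C\<bar> * (1 + d)"
  define w where "w k = real k powr s * u k" for k
  have d: "d > 0" using s by (simp add: d_def)
  have w: "w k \<ge> 0" for k using nn by (simp add: w_def)
  have w_step: "(1 + d / real k) * w (Suc k) \<le> w k + C' / real k"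
    if k: "k \<ge> 1" and r: "u (Suc k) \<le> (1 - c / real k) * u k + C / real k ^ 3" for k
  proof -
    have k0: "real k > 0" using k by simp
    have "w (Suc k) \<le> real (Suc k) powr s * ((1 - c / real k) * u k + C / real k ^ 3)"
      unfolding w_def by (intro mult_left_mono r) simp
    also have "\<dots> = real (Suc k) powr s * (1 - c / real k) * u k + real (Suc k) powr s * C / real k ^ 3"
      by (simp add: algebra_simps)
    also have "\<dots> \<le> exp (- (d / real k)) * w k + 4 * \<bar>C\<bar> / real k"
    proof (rule add_mono)
      have "real (Suc k) powr s = real k powr s * (1 + 1 / real k) powr s"
      proof -
        have "real (Suc k) = real k * (1 + 1 / real k)" using k0 by (simp add: field_simps)
        then show ?thesis using k0 by (simp add: powr_mult)
      qed
      also have "\<dots> \<le> real k powr s * exp (1 / real k) powr s"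
        using s by (intro mult_left_mono powr_mono2 exp_ge_add_one_self) auto
      finally have p: "real (Suc k) powr s \<le> real k powr s * exp (s / real k)"
        by (simp add: powr_def)
      have "real (Suc k) powr s * (1 - c / real k) \<le> real (Suc k) powr s * exp (- (c / real k))"
        using exp_ge_add_one_self[of "- (c / real k)"] by (intro mult_left_mono) auto
      also have "\<dots> \<le> (real k powr s * exp (s / real k)) * exp (- (c / real k))"
        using p by (intro mult_right_mono) auto
      also have "\<dots> = real k powr s * exp (- (d / real k))"
        by (simp add: d_def exp_diff exp_minus diff_divide_distrib field_simps)
      finally have "real (Suc k) powr s * (1 - c / real k) * u k \<le> (real k powr s * exp (- (d / real k))) * u k"
        by (rule mult_right_mono) (rule nn)
      then show "real (Suc k) powr s * (1 - c / real k) * u k \<le> exp (- (d / real k)) * w k"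
        by (simp add: w_def algebra_simps)
      have "real (Suc k) powr s \<le> real (Suc k) powr 2" using s by (intro powr_mono) auto
      also have "\<dots> = real (Suc k) ^ 2" by (simp add: powr_numeral)
      also have "\<dots> \<le> (2 * real k) ^ 2" using k by (intro power_mono) auto
      finally have q: "real (Suc k) powr s \<le> 4 * real k ^ 2" by simp
      have "real (Suc k) powr s * C / real k ^ 3 \<le> real (Suc k) powr s * \<bar>C\<bar> / real k ^ 3"
        by (intro divide_right_mono mult_left_mono) auto
      also have "\<dots> \<le> 4 * real k ^ 2 * \<bar>C\<bar> / real k ^ 3"
        by (intro divide_right_mono mult_right_mono q) auto
      also have "\<dots> = 4 * \<bar>C\<bar> / real k" using k0 by (simp add: power2_eq_square power3_eq_cube field_simps)
      finally show "real (Suc k) powr s * C / real k ^ 3 \<le> 4 * \<bar>C\<bar> / real k" .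
    qed
    finally have "(1 + d / real k) * w (Suc k) \<le> (1 + d / real k) * (exp (- (d / real k)) * w k + 4 * \<bar>C\<bar> / real k)"
      using d k0 by (intro mult_left_mono) auto
    also have "\<dots> = ((1 + d / real k) * exp (- (d / real k))) * w k + (1 + d / real k) * (4 * \<bar>C\<bar> / real k)"
      by (simp add: algebra_simps)
    also have "\<dots> \<le> 1 * w k + (1 + d) * (4 * \<bar>C\<bar> / real k)"
    proof (intro add_mono mult_right_mono w)
      show "(1 + d / real k) * exp (- (d / real k)) \<le> 1"
        using exp_ge_add_one_self[of "d / real k"] by (simp add: exp_minus field_simps)
      show "d / real k \<le> d" using k d by (simp add: field_simps)
    qed auto
    finally show ?thesis by (simp add: C'_def algebra_simps)
  qed
  obtain N0 where N0: "\<And>k. k \<ge> N0 \<Longrightarrow> u (Suc k) \<le> (1 - c / real k) * u k + C / real k ^ 3"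
    using rec unfolding eventually_sequentially by blast
  define N where "N = max N0 1"
  define R where "R = max (w N) (C' / d)"
  have "w k \<le> R" if "k \<ge> N" for k using that
  proof (induction k rule: dec_induct)
    case base show ?case by (simp add: R_def)
  next
    case (step k)
    have k: "k \<ge> 1" "k \<ge> N0" using step.hyps by (auto simp: N_def)
    have "C' \<le> d * R" using d by (simp add: R_def field_simps max_def)
    have "(1 + d / real k) * w (Suc k) \<le> R + (d * R) / real k"
      using \<open>C' \<le> d * R\<close> step.IH w_step[OF k(1) N0[OF k(2)]]
      by (smt (verit) divide_right_mono of_nat_0_le_iff)
    also have "\<dots> = (1 + d / real k) * R" by (simp add: algebra_simps)
    finally have "(1 + d / real k) * w (Suc k) \<le> (1 + d / real k) * R" .
    moreover have "1 + d / real k > 0" using d by (intro add_pos_nonneg) auto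
    ultimately show ?case by (rule mult_left_le_imp_le)
  qed
  then have "\<forall>\<^sub>F k in sequentially. norm (u k) \<le> R * norm (real k powr (- s))"
    unfolding eventually_sequentially
  proof (intro exI[of _ N] allI impI)
    fix k assume k: "k \<ge> N" and "\<And>k. k \<ge> N \<Longrightarrow> w k \<le> R"
    then have "w k \<le> R" "k > 0" by (auto simp: N_def)
    then show "norm (u k) \<le> R * norm (real k powr (- s))"
      using nn[of k] by (simp add: w_def powr_minus field_simps)
  qed
  then show ?thesis by (rule bigoI)
qed

lemma power_decay_tendsto_0:
  fixes f :: "nat \<Rightarrow> real"
  assumes "f \<in> O(\<lambda>k. real k powr - s)" "s > 0"
  shows "f \<longlonglongrightarrow> 0"
proof -
  have lim: "(\<lambda>k. real k powr - s) \<longlonglongrightarrow> 0"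
    using \<open>s > 0\<close> by (intro tendsto_neg_powr filterlim_real_sequentially) auto
  obtain C where "\<forall>\<^sub>F k in sequentially. norm (f k) \<le> C * norm (real k powr - s)"
    using landau_o.bigE[OF assms(1)] by blast
  then show ?thesis
    by (intro tendsto_0_le[OF lim, of _ C]) (simp add: mult.commute)
qed

section \<open>One step of the regularized extragradient method\<close>

text \<open>
  Expand \<open>x - p\<close> around \<open>x'\<close> and then \<open>x - x'\<close> around \<open>y\<close>. The monotone term at \<open>y\<close> has the
  good sign. In the cross term, \<open>x - y - \<theta> M y\<close> equals \<open>a x + \<theta> (M x - M y)\<close>: the Lipschitz
  part uses up a fraction \<open>\<theta> L\<close> of \<open>\<parallel>x - y\<parallel>\<^sup>2 + \<parallel>y - x'\<parallel>\<^sup>2\<close>, and what is left of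
  \<open>\<parallel>y - x'\<parallel>\<^sup>2\<close> absorbs the part with \<open>a x\<close> by Young's inequality.
\<close>
lemma fejer_step:
  fixes M :: "'a::real_inner \<Rightarrow> 'a"
  assumes mono: "monotone_operator M" and lip: "L-lipschitz_on UNIV M"
    and \<theta>: "0 \<le> \<theta>" "\<theta> * L < 1" and p: "M p = 0"
    and y: "y = x - a *\<^sub>R x - \<theta> *\<^sub>R M x" and x': "x' = x - b *\<^sub>R x' - \<theta> *\<^sub>R M y"
  shows "(norm (x' - p))\<^sup>2 + 2 * b * (x' \<bullet> (x' - p))
    \<le> (norm (x - p))\<^sup>2 + a\<^sup>2 * (norm x)\<^sup>2 / (1 - \<theta> * L)"
proof -
  define c where "c = 1 - \<theta> * L"
  define v where "v = norm (y - x')"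
  define e where "e = \<theta> *\<^sub>R (M x - M y)"
  have c: "c > 0" using \<theta> by (simp add: c_def)
  have hy: "x - x' = b *\<^sub>R x' + \<theta> *\<^sub>R M y" using x' by (simp add: algebra_simps)
  have xy: "x - y - \<theta> *\<^sub>R M y = a *\<^sub>R x + e" by (simp add: y e_def algebra_simps)
  have "norm e \<le> \<theta> * (L * norm (x - y))"
    using lipschitz_onD[OF lip, of x y] \<theta>(1) by (simp add: e_def dist_norm mult_left_mono)
  then have "norm e * v \<le> \<theta> * (L * norm (x - y)) * v"
    by (rule mult_right_mono) (simp add: v_def)
  moreover have "\<bar>e \<bullet> (y - x')\<bar> \<le> norm e * v"
    unfolding v_def by (rule Cauchy_Schwarz_ineq2)
  moreover have "\<theta> * L * (2 * (norm (x - y) * v)) \<le> \<theta> * L * ((norm (x - y))\<^sup>2 + v\<^sup>2)"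
    using sum_squares_bound[of "norm (x - y)" v] \<theta>(1) lipschitz_on_nonneg[OF lip]
    by (intro mult_left_mono) auto
  ultimately have e: "2 * (e \<bullet> (y - x')) \<ge> - (\<theta> * L * ((norm (x - y))\<^sup>2 + v\<^sup>2))"
    by (simp add: algebra_simps)
  have "\<bar>(a *\<^sub>R x) \<bullet> (y - x')\<bar> \<le> norm (a *\<^sub>R x) * v"
    unfolding v_def by (rule Cauchy_Schwarz_ineq2)
  moreover have "0 \<le> (norm (a *\<^sub>R x) - c * v)\<^sup>2 / c" using c by simp
  then have "2 * (norm (a *\<^sub>R x) * v) \<le> c * v\<^sup>2 + (norm (a *\<^sub>R x))\<^sup>2 / c"
    using c by (simp add: power2_diff field_simps power2_eq_square)
  ultimately have ax: "2 * ((a *\<^sub>R x) \<bullet> (y - x')) \<ge> - (c * v\<^sup>2 + a\<^sup>2 * (norm x)\<^sup>2 / c)"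
    by (simp add: power_mult_distrib abs_le_iff)
  have "0 \<le> (M y - M p) \<bullet> (y - p)" using mono by (simp add: monotone_operator_def)
  then have my: "0 \<le> 2 * (\<theta> * (M y \<bullet> (y - p)))" using \<theta>(1) by (simp add: p)
  have "(norm (x - p))\<^sup>2 = (norm (x' - p))\<^sup>2 + 2 * ((x - x') \<bullet> (x' - p)) + (norm (x - x'))\<^sup>2"
    unfolding power2_norm_eq_inner by (simp add: inner_diff inner_commute algebra_simps)
  also have "(x - x') \<bullet> (x' - p) = b * (x' \<bullet> (x' - p)) + \<theta> * (M y \<bullet> (y - p)) - (\<theta> *\<^sub>R M y) \<bullet> (y - x')"
    unfolding hy by (simp add: inner_add inner_diff algebra_simps)
  also have "(norm (x - x'))\<^sup>2 = (norm (x - y))\<^sup>2 + v\<^sup>2 + 2 * ((x - y) \<bullet> (y - x'))"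
    unfolding power2_norm_eq_inner v_def by (simp add: inner_diff inner_commute algebra_simps)
  finally have "(norm (x - p))\<^sup>2 = (norm (x' - p))\<^sup>2 + 2 * b * (x' \<bullet> (x' - p)) + 2 * (\<theta> * (M y \<bullet> (y - p)))
      + (norm (x - y))\<^sup>2 + v\<^sup>2 + 2 * ((x - y - \<theta> *\<^sub>R M y) \<bullet> (y - x'))"
    by (simp add: inner_diff_left algebra_simps)
  also have "(x - y - \<theta> *\<^sub>R M y) \<bullet> (y - x') = (a *\<^sub>R x) \<bullet> (y - x') + e \<bullet> (y - x')"
    unfolding xy by (rule inner_add_left)
  finally have eq: "(norm (x - p))\<^sup>2 = (norm (x' - p))\<^sup>2 + 2 * b * (x' \<bullet> (x' - p)) + 2 * (\<theta> * (M y \<bullet> (y - p)))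
      + (norm (x - y))\<^sup>2 + v\<^sup>2 + 2 * ((a *\<^sub>R x) \<bullet> (y - x') + e \<bullet> (y - x'))" .
  have "(norm (x - y))\<^sup>2 + v\<^sup>2 - \<theta> * L * ((norm (x - y))\<^sup>2 + v\<^sup>2) = c * (norm (x - y))\<^sup>2 + c * v\<^sup>2"
    by (simp add: c_def algebra_simps)
  moreover have "0 \<le> c * (norm (x - y))\<^sup>2" using c by simp
  ultimately show ?thesis using eq e ax my unfolding c_def[symmetric] distrib_left by argo
qed

text \<open>
  With \<open>h = b x' + \<theta> M y\<close> one has \<open>g' - h = \<theta> (M x' - M y)\<close> and \<open>x' - y = g - h\<close>, so the
  distance of \<open>g'\<close> to \<open>h\<close> is at most \<open>\<theta> L\<close> times that of \<open>g\<close>. The identity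
  \<open>\<parallel>g\<parallel>\<^sup>2 - \<parallel>g'\<parallel>\<^sup>2 = \<parallel>g - h\<parallel>\<^sup>2 - \<parallel>g' - h\<parallel>\<^sup>2 + 2 \<langle>g - g', h\<rangle>\<close> turns this into a decrease, the
  last term being controlled by monotonicity of \<open>M\<close> between \<open>x\<close> and \<open>x' = x - h\<close>.
\<close>
lemma residual_step:
  fixes M :: "'a::real_inner \<Rightarrow> 'a"
  assumes mono: "monotone_operator M" and lip: "L-lipschitz_on UNIV M"
    and \<theta>: "0 \<le> \<theta>" and ab: "b \<le> a"
    and y: "y = x - a *\<^sub>R x - \<theta> *\<^sub>R M x" and x': "x' = x - b *\<^sub>R x' - \<theta> *\<^sub>R M y"
  defines "g \<equiv> a *\<^sub>R x + \<theta> *\<^sub>R M x" and "g' \<equiv> b *\<^sub>R x' + \<theta> *\<^sub>R M x'" and "h \<equiv> x - x'"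
  shows "(norm g')\<^sup>2 \<le> (norm g)\<^sup>2 - (1 - (\<theta> * L)\<^sup>2) * (norm (g - h))\<^sup>2
    - 2 * b * (norm h)\<^sup>2 + 2 * (a - b) * (norm x * norm h)"
proof -
  have "h = b *\<^sub>R x' + \<theta> *\<^sub>R M y" using x' by (simp add: h_def algebra_simps)
  then have 1: "g' - h = \<theta> *\<^sub>R (M x' - M y)" by (simp add: g'_def algebra_simps)
  have 2: "x' - y = g - h" by (simp add: y g_def h_def)
  have "norm (g' - h) \<le> \<theta> * (L * norm (x' - y))"
    using lipschitz_onD[OF lip, of x' y] \<theta> unfolding 1 by (simp add: dist_norm mult_left_mono)
  then have "norm (g' - h) \<le> \<theta> * L * norm (g - h)" by (simp add: 2)
  then have "(norm (g' - h))\<^sup>2 \<le> (\<theta> * L * norm (g - h))\<^sup>2" by (rule power_mono) simp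
  then have A: "(norm (g' - h))\<^sup>2 \<le> (\<theta> * L)\<^sup>2 * (norm (g - h))\<^sup>2" by (simp add: power_mult_distrib)
  have "0 \<le> \<theta> * ((M x - M x') \<bullet> (x - x'))" using mono \<theta> by (simp add: monotone_operator_def)
  also have "\<dots> = (g - g') \<bullet> h - b * (norm h)\<^sup>2 - (a - b) * (x \<bullet> h)"
    unfolding g_def g'_def h_def power2_norm_eq_inner
    by (simp add: inner_diff inner_add inner_commute algebra_simps)
  finally have B: "(g - g') \<bullet> h \<ge> b * (norm h)\<^sup>2 + (a - b) * (x \<bullet> h)" by simp
  have "- (x \<bullet> h) \<le> norm x * norm h" using Cauchy_Schwarz_ineq2[of x h] by simp
  then have "(a - b) * (- (x \<bullet> h)) \<le> (a - b) * (norm x * norm h)" using ab by (intro mult_left_mono) auto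
  then have C: "(a - b) * (x \<bullet> h) \<ge> - ((a - b) * (norm x * norm h))" by simp
  have "(norm g')\<^sup>2 = (norm g)\<^sup>2 - (norm (g - h))\<^sup>2 + (norm (g' - h))\<^sup>2 - 2 * ((g - g') \<bullet> h)"
    unfolding power2_norm_eq_inner by (simp add: inner_diff inner_commute algebra_simps)
  then show ?thesis using A B C by (simp add: algebra_simps)
qed

text \<open>
  The decrease in \<open>residual_step\<close> is stated in \<open>h\<close> and \<open>v = \<parallel>g - h\<parallel>\<close>, whereas a contraction needs
  \<open>\<parallel>g\<parallel>\<^sup>2\<close>. Since the coefficient \<open>\<kappa>\<close> of \<open>v\<^sup>2\<close> stays fixed while \<open>b\<close> tends to \<open>0\<close>, nearly all
  of \<open>2 b \<parallel>g\<parallel>\<^sup>2\<close> is available: \<open>(1 + q) b h\<^sup>2\<close> together with \<open>\<kappa> v\<^sup>2\<close> pays for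
  \<open>2 q b \<parallel>g\<parallel>\<^sup>2\<close>, and the remaining \<open>(1 - q) b h\<^sup>2\<close> for the drift term \<open>F b\<^sup>2 h\<close>
  up to an error of order \<open>b\<^sup>3\<close>.
\<close>
lemma residual_absorption:
  fixes q b \<kappa> F G h v :: real
  assumes q: "0 < q" "q < 1" and b: "b > 0" "b \<le> \<kappa> * (1 - q) / 4"
    and G: "0 \<le> G" "G \<le> h + v"
  shows "2 * q * b * G\<^sup>2 + F * b\<^sup>2 * h \<le> 2 * b * h\<^sup>2 + \<kappa> * v\<^sup>2 + F\<^sup>2 / (4 * (1 - q)) * b ^ 3"
proof -
  define t where "t = 1 - q"
  have t: "t > 0" "q = 1 - t" using q by (auto simp: t_def)
  \<comment> \<open>Young's inequality for the mixed term of \<open>2 q (h + v)\<^sup>2\<close>, leaving exactly \<open>1 + q = 2 - t\<close>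
      as the coefficient of \<open>h\<^sup>2\<close>.\<close>
  have "0 \<le> (t * h - 2 * q * v)\<^sup>2 / t" using t by simp
  also have "\<dots> = t * h\<^sup>2 - 4 * q * (h * v) + 4 * q\<^sup>2 / t * v\<^sup>2"
    using t(1) by (simp add: power2_diff field_simps power2_eq_square)
  finally have 1: "4 * q * (h * v) \<le> t * h\<^sup>2 + 4 * q\<^sup>2 / t * v\<^sup>2" by simp
  have "2 * q + 4 * q\<^sup>2 / t = 2 * q * (1 + q) / t"
    using t(1) by (simp add: t_def field_simps power2_eq_square)
  also have "\<dots> \<le> 4 / t"
    using mult_mono[of q 1 "1 + q" 2] q t(1) by (intro divide_right_mono) auto
  finally have 2: "(2 * q + 4 * q\<^sup>2 / t) * v\<^sup>2 \<le> 4 / t * v\<^sup>2" by (rule mult_right_mono) simp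
  have "2 * q * G\<^sup>2 \<le> 2 * q * (h + v)\<^sup>2" using q G by (intro mult_left_mono power_mono) auto
  also have "\<dots> = 2 * q * h\<^sup>2 + 4 * q * (h * v) + 2 * q * v\<^sup>2" by (simp add: power2_sum algebra_simps)
  also have "\<dots> \<le> (2 - t) * h\<^sup>2 + 4 / t * v\<^sup>2" using 1 2 by (simp add: t(2) algebra_simps)
  finally have "b * (2 * q * G\<^sup>2) \<le> b * ((2 - t) * h\<^sup>2 + 4 / t * v\<^sup>2)" using b by (intro mult_left_mono) auto
  moreover have "b * (4 / t) * v\<^sup>2 \<le> \<kappa> * v\<^sup>2"
    using b t by (intro mult_right_mono) (auto simp: field_simps)
  moreover have "0 \<le> b * (2 * t * h - F * b)\<^sup>2 / (4 * t)" using b t by simp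
  moreover have "b * (2 * t * h - F * b)\<^sup>2 / (4 * t) = b * t * h\<^sup>2 - F * b\<^sup>2 * h + F\<^sup>2 / (4 * t) * b ^ 3"
    using t(1) by (simp add: power2_diff field_simps power2_eq_square power3_eq_cube)
  ultimately show ?thesis unfolding t_def[symmetric] by (simp add: algebra_simps)
qed

section \<open>The method with parameters of order 1/k\<close>

locale tikhonov_extragradient =
  fixes M :: "'a::{real_inner, complete_space} \<Rightarrow> 'a"
    and L \<theta> \<alpha> \<beta> :: real
    and a :: "nat \<Rightarrow> real"
    and x y :: "nat \<Rightarrow> 'a"
  assumes mono: "monotone_operator M"
    and lip: "L-lipschitz_on UNIV M"
    and zer_nonempty: "zer M \<noteq> {}"
    and \<theta>: "0 < \<theta>" "\<theta> * L < 1"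
    and \<alpha>: "\<alpha> > 0" and \<beta>: "\<beta> > 0"
    and a_def: "\<And>k. a k = \<alpha> / (real k + \<beta>)"
    and y: "\<And>k. y (Suc k) = x k - a k *\<^sub>R x k - \<theta> *\<^sub>R M (x k)"
    and x: "\<And>k. x (Suc k) = x k - a (Suc k) *\<^sub>R x (Suc k) - \<theta> *\<^sub>R M (y (Suc k))"
begin

definition residual :: "nat \<Rightarrow> 'a"
  where "residual k = a k *\<^sub>R x k + \<theta> *\<^sub>R M (x k)"

lemma a_pos: "a k > 0"
  using \<alpha> \<beta> by (simp add: a_def add_nonneg_pos)

lemma a_diff: "a k - a (Suc k) = a k * a (Suc k) / \<alpha>"
proof -
  define t where "t = real k + \<beta>"
  have "t > 0" using \<beta> by (simp add: t_def add_nonneg_pos)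
  then have "\<alpha> / t - \<alpha> / (t + 1) = \<alpha> / (t * (t + 1))"
    by (simp add: diff_frac_eq algebra_simps)
  also have "\<dots> = \<alpha> / t * (\<alpha> / (t + 1)) / \<alpha>" using \<alpha> by simp
  finally show ?thesis by (simp add: a_def t_def add_ac)
qed

lemma a_Suc_le: "a (Suc k) \<le> a k"
proof -
  have "0 \<le> a k * a (Suc k) / \<alpha>" using a_pos[of k] a_pos[of "Suc k"] \<alpha> by simp
  then show ?thesis by (simp flip: a_diff)
qed

lemma a_le: "k \<ge> 1 \<Longrightarrow> a k \<le> \<alpha> / real k"
  using \<alpha> \<beta> by (simp add: a_def frac_le)

lemma a_tendsto_0: "a \<longlonglongrightarrow> 0"
proof (rule tendsto_sandwich[of "\<lambda>_. 0" _ _ "\<lambda>k. \<alpha> / real k"])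
  show "\<forall>\<^sub>F k in sequentially. a k \<le> \<alpha> / real k"
    using a_le by (auto simp: eventually_sequentially)
  show "(\<lambda>k. \<alpha> / real k) \<longlonglongrightarrow> 0" by (rule lim_const_over_n)
  show "\<forall>\<^sub>F k in sequentially. 0 \<le> a k"
    using a_pos by (intro always_eventually allI less_imp_le)
qed simp

lemma eventually_a_Suc_le: "c > 0 \<Longrightarrow> \<forall>\<^sub>F k in sequentially. a (Suc k) \<le> c"
  by (rule eventually_mono[OF order_tendstoD(2)[OF LIMSEQ_Suc[OF a_tendsto_0]]]) auto

lemma eventually_a_le_twice: "\<forall>\<^sub>F k in sequentially. a k \<le> 2 * a (Suc k)"
  using eventually_ge_at_top[of 1]
proof eventually_elim
  case (elim k)
  then have "real k + \<beta> > 0" "real (Suc k) + \<beta> \<le> 2 * (real k + \<beta>)" using \<beta> by auto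
  then have "2 * \<alpha> / (2 * (real k + \<beta>)) \<le> 2 * \<alpha> / (real (Suc k) + \<beta>)"
    using \<alpha> \<beta> by (intro divide_left_mono) auto
  also have "2 * \<alpha> / (2 * (real k + \<beta>)) = a k" by (simp only: a_def mult_divide_mult_cancel_left_if) simp
  finally show ?case by (simp add: a_def)
qed

lemma eventually_a_Suc_ge:
  assumes "\<gamma> < \<alpha>"
  shows "\<forall>\<^sub>F k in sequentially. \<gamma> / real k \<le> a (Suc k)"
  using eventually_ge_at_top[of "nat \<lceil>\<bar>\<gamma>\<bar> * (1 + \<beta>) / (\<alpha> - \<gamma>)\<rceil>"] eventually_gt_at_top[of 0]
proof eventually_elim
  case (elim k)
  have "\<bar>\<gamma>\<bar> * (1 + \<beta>) / (\<alpha> - \<gamma>) \<le> real k" using elim by linarith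
  then have "\<bar>\<gamma>\<bar> * (1 + \<beta>) \<le> (\<alpha> - \<gamma>) * real k" using assms by (simp add: field_simps)
  moreover have "\<gamma> * (1 + \<beta>) \<le> \<bar>\<gamma>\<bar> * (1 + \<beta>)" using \<beta> by (intro mult_right_mono) auto
  ultimately have "\<gamma> * (real (Suc k) + \<beta>) \<le> \<alpha> * real k" by (simp add: algebra_simps)
  moreover have "real (Suc k) + \<beta> > 0" using \<beta> by simp
  ultimately show ?case using elim by (simp add: a_def field_simps)
qed

lemma fejer:
  assumes "p \<in> zer M"
  shows "(norm (x (Suc k) - p))\<^sup>2 + 2 * a (Suc k) * (x (Suc k) \<bullet> (x (Suc k) - p))
    \<le> (norm (x k - p))\<^sup>2 + (a k)\<^sup>2 * (norm (x k))\<^sup>2 / (1 - \<theta> * L)"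
  by (rule fejer_step[OF mono lip _ _ _ y x]) (use \<theta> assms in \<open>auto simp: zer_def\<close>)

text \<open>
  Since \<open>2 \<langle>x', x' - p\<rangle> \<ge> \<parallel>x' - p\<parallel>\<^sup>2 - \<parallel>p\<parallel>\<^sup>2\<close>, the regularization contracts the squared
  distance \<open>D\<close> to \<open>p\<close> with factor \<open>1 + a\<^sub>k\<^sub>+\<^sub>1\<close>, and once \<open>a\<close> is small the error
  \<open>a\<^sub>k\<^sup>2 \<parallel>x\<^sub>k\<parallel>\<^sup>2\<close> gives back at most half of this. The set \<open>D \<le> R\<close> is then invariant for
  \<open>R \<ge> 3 \<parallel>p\<parallel>\<^sup>2\<close>. Only a tail is controlled in this way, as early parameters may be large.
\<close>
lemma eventually_bounded: obtains B where "B \<ge> 0" "\<forall>\<^sub>F k in sequentially. norm (x k) \<le> B"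
proof -
  obtain p where p: "p \<in> zer M" using zer_nonempty by auto
  define c where "c = 1 - \<theta> * L"
  define D where "D k = (norm (x k - p))\<^sup>2" for k
  define P where "P = (norm p)\<^sup>2"
  have c: "c > 0" "c / 16 > 0" using \<theta> by (simp_all add: c_def)
  have "\<forall>\<^sub>F k in sequentially. (1 + a (Suc k)) * D (Suc k) \<le> (1 + a (Suc k) / 2) * D k + 3 / 2 * a (Suc k) * P"
    using eventually_a_Suc_le[OF c(2)] eventually_a_le_twice
  proof eventually_elim
    case (elim k)
    define b where "b = a (Suc k)"
    have b: "b > 0" "b \<le> c / 16" using a_pos elim by (auto simp: b_def)
    have "(a k)\<^sup>2 \<le> (2 * b)\<^sup>2" using a_pos[of k] elim by (intro power_mono) (auto simp: b_def)
    also have "\<dots> = 4 * b * b" by (simp add: power2_eq_square)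
    also have "\<dots> \<le> 4 * b * (c / 16)" using b by (intro mult_left_mono) auto
    finally have ab: "(a k)\<^sup>2 / c \<le> b / 4" using c by (simp add: field_simps)
    have "norm (x k) \<le> norm (x k - p) + norm p" using norm_triangle_ineq[of "x k - p" p] by simp
    then have "(norm (x k))\<^sup>2 \<le> (norm (x k - p) + norm p)\<^sup>2" by (rule power_mono) simp
    also have "\<dots> \<le> 2 * D k + 2 * P"
      using sum_squares_bound[of "norm (x k - p)" "norm p"] by (simp add: D_def P_def power2_sum)
    finally have xk: "(norm (x k))\<^sup>2 \<le> 2 * D k + 2 * P" .
    have "(a k)\<^sup>2 * (norm (x k))\<^sup>2 / c = (a k)\<^sup>2 / c * (norm (x k))\<^sup>2" by simp
    also have "\<dots> \<le> b / 4 * (2 * D k + 2 * P)" using ab xk b by (intro mult_mono) auto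
    finally have err: "(a k)\<^sup>2 * (norm (x k))\<^sup>2 / c \<le> b / 2 * D k + b / 2 * P" by (simp add: algebra_simps)
    have "2 * (x (Suc k) \<bullet> (x (Suc k) - p)) = D (Suc k) + (norm (x (Suc k)))\<^sup>2 - P"
      unfolding D_def P_def power2_norm_eq_inner by (simp add: inner_diff inner_commute)
    then have "2 * (x (Suc k) \<bullet> (x (Suc k) - p)) \<ge> D (Suc k) - P" by simp
    then have "b * (2 * (x (Suc k) \<bullet> (x (Suc k) - p))) \<ge> b * (D (Suc k) - P)"
      using b by (intro mult_left_mono) auto
    then show ?case using fejer[OF p, of k] err
      unfolding c_def[symmetric] b_def[symmetric] D_def[symmetric] by (simp add: algebra_simps)
  qed
  then obtain N where N: "\<And>k. k \<ge> N \<Longrightarrow>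
      (1 + a (Suc k)) * D (Suc k) \<le> (1 + a (Suc k) / 2) * D k + 3 / 2 * a (Suc k) * P"
    unfolding eventually_sequentially by blast
  define R where "R = max (D N) (3 * P)"
  have R: "D k \<le> R" if "k \<ge> N" for k using that
  proof (induction k rule: dec_induct)
    case base show ?case by (simp add: R_def)
  next
    case (step k)
    have b: "a (Suc k) > 0" by (rule a_pos)
    have "(1 + a (Suc k)) * D (Suc k) \<le> (1 + a (Suc k) / 2) * D k + 3 / 2 * a (Suc k) * P"
      by (rule N[OF step.hyps(1)])
    also have "\<dots> \<le> (1 + a (Suc k) / 2) * R + a (Suc k) / 2 * R"
    proof (rule add_mono)
      show "(1 + a (Suc k) / 2) * D k \<le> (1 + a (Suc k) / 2) * R"
        using step.IH b by (intro mult_left_mono) auto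
      have "a (Suc k) / 2 * (3 * P) \<le> a (Suc k) / 2 * R" using b by (intro mult_left_mono) (auto simp: R_def)
      then show "3 / 2 * a (Suc k) * P \<le> a (Suc k) / 2 * R" by (simp add: algebra_simps)
    qed
    also have "\<dots> = (1 + a (Suc k)) * R" by (simp add: algebra_simps)
    finally show ?case using b by (simp add: add_pos_pos)
  qed
  have "norm (x k) \<le> norm p + sqrt R" if "k \<ge> N" for k
  proof -
    have "norm (x k - p) \<le> sqrt R" using R[OF that] by (simp add: D_def real_le_rsqrt)
    then show ?thesis using norm_triangle_ineq[of "x k - p" p] by simp
  qed
  moreover have "R \<ge> 0" by (auto simp: R_def P_def le_max_iff_disj)
  ultimately show ?thesis
    using that[of "norm p + sqrt R"] by (auto simp: eventually_sequentially)
qed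

text \<open>
  The drift term of \<open>residual_step\<close> is of the form required by \<open>residual_absorption\<close> because
  \<open>a\<^sub>k - a\<^sub>k\<^sub>+\<^sub>1 = a\<^sub>k a\<^sub>k\<^sub>+\<^sub>1 / \<alpha> \<le> 2 a\<^sub>k\<^sub>+\<^sub>1\<^sup>2 / \<alpha>\<close> for large \<open>k\<close>.
\<close>
lemma residual_recursion:
  assumes q: "0 < q" "q < 1"
  obtains E where "E \<ge> 0" "\<forall>\<^sub>F k in sequentially.
    (norm (residual (Suc k)))\<^sup>2 \<le> (1 - 2 * q * a (Suc k)) * (norm (residual k))\<^sup>2 + E * a (Suc k) ^ 3"
proof -
  obtain B where B: "B \<ge> 0" "\<forall>\<^sub>F k in sequentially. norm (x k) \<le> B" by (rule eventually_bounded)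
  define \<kappa> where "\<kappa> = 1 - (\<theta> * L)\<^sup>2"
  define F where "F = 4 * B / \<alpha>"
  have "0 \<le> \<theta> * L" using \<theta> lipschitz_on_nonneg[OF lip] by simp
  then have \<kappa>: "\<kappa> > 0" using \<theta> by (simp add: \<kappa>_def power_less_one_iff)
  then have pos: "\<kappa> * (1 - q) / 4 > 0" using q by simp
  have "\<forall>\<^sub>F k in sequentially. (norm (residual (Suc k)))\<^sup>2
      \<le> (1 - 2 * q * a (Suc k)) * (norm (residual k))\<^sup>2 + F\<^sup>2 / (4 * (1 - q)) * a (Suc k) ^ 3"
    using eventually_a_Suc_le[OF pos] eventually_a_le_twice B(2)
  proof eventually_elim
    case (elim k)
    define b where "b = a (Suc k)"
    define g where "g = residual k"
    define h where "h = x k - x (Suc k)"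
    have b: "b > 0" by (simp add: b_def a_pos)
    have "b \<le> \<kappa> * (1 - q) / 4" using elim \<kappa> q by (simp add: b_def)
    moreover have "norm g \<le> norm h + norm (g - h)" using norm_triangle_ineq[of h "g - h"] by simp
    ultimately have abs: "2 * q * b * (norm g)\<^sup>2 + F * b\<^sup>2 * norm h
        \<le> 2 * b * (norm h)\<^sup>2 + \<kappa> * (norm (g - h))\<^sup>2 + F\<^sup>2 / (4 * (1 - q)) * b ^ 3"
      using b q by (intro residual_absorption) auto
    have "a k - b = a k * b / \<alpha>" unfolding b_def by (rule a_diff)
    also have "\<dots> \<le> 2 * b * b / \<alpha>"
      using elim b \<alpha> by (intro divide_right_mono mult_right_mono) (auto simp: b_def)
    finally have "2 * (a k - b) * (norm (x k) * norm h) \<le> 2 * (2 * b * b / \<alpha>) * (B * norm h)"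
      using elim B(1) b \<alpha> a_Suc_le[of k] by (intro mult_mono) (auto simp: b_def)
    then have drift: "2 * (a k - b) * (norm (x k) * norm h) \<le> F * b\<^sup>2 * norm h"
      by (simp add: F_def power2_eq_square algebra_simps)
    have "(norm (residual (Suc k)))\<^sup>2 \<le> (norm g)\<^sup>2 - \<kappa> * (norm (g - h))\<^sup>2
        - 2 * b * (norm h)\<^sup>2 + 2 * (a k - b) * (norm (x k) * norm h)"
      unfolding \<kappa>_def g_def h_def b_def residual_def
      by (rule residual_step[OF mono lip _ a_Suc_le y x]) (use \<theta> in simp)
    then show ?case using abs drift
      unfolding b_def[symmetric] g_def[symmetric] by (simp add: algebra_simps)
  qed
  then show ?thesis using that[of "F\<^sup>2 / (4 * (1 - q))"] q by simp
qed

lemma residual_decay: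
  assumes s: "0 < s" "s < \<alpha>" "s \<le> 1"
  shows "(\<lambda>k. (norm (residual k))\<^sup>2) \<in> O(\<lambda>k. real k powr - (2 * s))"
proof -
  \<comment> \<open>The factor \<open>1 - 2 q a\<^sub>k\<^sub>+\<^sub>1\<close> has to beat \<open>1 - 2 s / k\<close> with room for two losses:
      \<open>2 s < c < 2 q \<alpha> < 2 \<alpha>\<close>, where \<open>c\<close> and then \<open>2 q \<alpha>\<close> are midpoints.\<close>
  define q where "q = (3 * \<alpha> + s) / (4 * \<alpha>)"
  define c where "c = \<alpha> + s"
  have q: "0 < q" "q < 1" using s \<alpha> by (auto simp: q_def field_simps)
  have "2 * q * \<alpha> > c" using s \<alpha> by (simp add: q_def c_def field_simps)
  then have "c / (2 * q) < \<alpha>" using q by (simp add: field_simps)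
  note lower = eventually_a_Suc_ge[OF this]
  obtain E where E: "E \<ge> 0" "\<forall>\<^sub>F k in sequentially.
      (norm (residual (Suc k)))\<^sup>2 \<le> (1 - 2 * q * a (Suc k)) * (norm (residual k))\<^sup>2 + E * a (Suc k) ^ 3"
    using residual_recursion[OF q] by blast
  show ?thesis
  proof (rule power_decay_of_recursion)
    show "\<forall>\<^sub>F k in sequentially. (norm (residual (Suc k)))\<^sup>2
        \<le> (1 - c / real k) * (norm (residual k))\<^sup>2 + (E * \<alpha> ^ 3) / real k ^ 3"
      using lower E(2) eventually_ge_at_top[of 1]
    proof eventually_elim
      case (elim k)
      have "2 * q * (c / (2 * q) / real k) \<le> 2 * q * a (Suc k)" using elim(1) q by (intro mult_left_mono) auto
      then have 1: "c / real k \<le> 2 * q * a (Suc k)" using q by simp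
      have "a (Suc k) \<le> \<alpha> / real k" using a_Suc_le a_le[OF elim(3)] by (rule order_trans)
      then have "a (Suc k) ^ 3 \<le> (\<alpha> / real k) ^ 3" using a_pos by (intro power_mono) (auto intro: less_imp_le)
      then have 2: "E * a (Suc k) ^ 3 \<le> E * (\<alpha> / real k) ^ 3" using E(1) by (rule mult_left_mono)
      have "(1 - 2 * q * a (Suc k)) * (norm (residual k))\<^sup>2 \<le> (1 - c / real k) * (norm (residual k))\<^sup>2"
        using 1 by (intro mult_right_mono) auto
      then show ?case using elim(2) 2 by (simp add: power_divide)
    qed
  qed (use s in \<open>auto simp: c_def\<close>)
qed

lemma operator_decay:
  assumes s: "0 < s" "s < \<alpha>" "s \<le> 1"
  shows "(\<lambda>k. norm (M (x k))) \<in> O(\<lambda>k. real k powr - s)"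
proof -
  obtain C where C: "C > 0"
    "\<forall>\<^sub>F k in sequentially. norm ((norm (residual k))\<^sup>2) \<le> C * norm (real k powr - (2 * s))"
    using landau_o.bigE[OF residual_decay[OF s]] by blast
  obtain B where B: "B \<ge> 0" "\<forall>\<^sub>F k in sequentially. norm (x k) \<le> B" by (rule eventually_bounded)
  have "\<forall>\<^sub>F k in sequentially. norm (norm (M (x k))) \<le> (sqrt C + \<alpha> * B) / \<theta> * norm (real k powr - s)"
    using C(2) B(2) eventually_ge_at_top[of 1]
  proof eventually_elim
    case (elim k)
    define t where "t = real k powr - s"
    have t: "t \<ge> 0" by (simp add: t_def)
    have "real k powr - (2 * s) = t\<^sup>2" by (simp add: t_def power2_eq_square flip: powr_add)
    then have "(norm (residual k))\<^sup>2 \<le> C * t\<^sup>2" using elim(1) by simp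
    also have "\<dots> = (sqrt C * t)\<^sup>2" using C(1) by (simp add: power_mult_distrib)
    finally have 1: "norm (residual k) \<le> sqrt C * t"
      by (rule power2_le_imp_le) (use C(1) t in simp)
    have "a k \<le> \<alpha> * real k powr - 1" using a_le[OF elim(3)] by (simp add: powr_minus_divide)
    also have "\<dots> \<le> \<alpha> * t"
      unfolding t_def using s elim(3) \<alpha> by (intro mult_left_mono powr_mono) auto
    finally have "norm (a k *\<^sub>R x k) \<le> (\<alpha> * t) * B"
      using elim(2) a_pos[of k] by (auto intro!: mult_mono)
    moreover have "\<theta> *\<^sub>R M (x k) = residual k - a k *\<^sub>R x k" by (simp add: residual_def)
    then have "\<theta> * norm (M (x k)) \<le> norm (residual k) + norm (a k *\<^sub>R x k)"
      by (metis \<theta>(1) norm_triangle_ineq4 norm_scaleR abs_of_pos)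
    ultimately have "\<theta> * norm (M (x k)) \<le> (sqrt C + \<alpha> * B) * t" using 1 by (simp add: algebra_simps)
    then show ?case using \<theta> t unfolding t_def[symmetric] by (simp add: field_simps)
  qed
  then show ?thesis by (rule bigoI)
qed

lemma operator_tendsto_0: "(\<lambda>k. M (x k)) \<longlonglongrightarrow> 0"
proof -
  define s where "s = min 1 (\<alpha> / 2)"
  have s: "0 < s" "s < \<alpha>" "s \<le> 1" using \<alpha> by (auto simp: s_def)
  have "(\<lambda>k. norm (M (x k))) \<longlonglongrightarrow> 0" by (rule power_decay_tendsto_0[OF operator_decay[OF s] s(1)])
  then show ?thesis by (rule tendsto_norm_zero_cancel)
qed

text \<open>
  Writing \<open>\<langle>x', x' - p\<rangle> = \<parallel>x' - p\<parallel>\<^sup>2 - \<langle>p, p - x'\<rangle>\<close> in the Fejer inequality, the excess of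
  \<open>\<parallel>x\<^sub>k - p\<parallel>\<^sup>2\<close> over any \<open>\<eta> > 0\<close> eventually satisfies an error-free recursion with factor
  \<open>1 - (\<alpha> / 2) / k\<close>: half of the gain \<open>2 a\<^sub>k\<^sub>+\<^sub>1 \<eta>\<close> pays for the inner product, the other half
  for the error \<open>O(a\<^sub>k\<^sup>2)\<close>. Hence the excess tends to \<open>0\<close>.
\<close>
lemma strong_convergence:
  assumes p: "p \<in> zer M"
    and obtuse: "\<And>\<eta>. \<eta> > 0 \<Longrightarrow> \<forall>\<^sub>F k in sequentially. p \<bullet> (p - x k) < \<eta>"
  shows "x \<longlonglongrightarrow> p"
proof -
  define D where "D k = (norm (x k - p))\<^sup>2" for k
  obtain B where B: "B \<ge> 0" "\<forall>\<^sub>F k in sequentially. norm (x k) \<le> B" by (rule eventually_bounded)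
  define c where "c = 1 - \<theta> * L"
  have c: "c > 0" using \<theta> by (simp add: c_def)
  have "\<forall>\<^sub>F k in sequentially. D k < e" if e: "e > 0" for e
  proof -
    define \<eta> where "\<eta> = e / 2"
    have \<eta>: "\<eta> > 0" using e by (simp add: \<eta>_def)
    define u where "u k = max 0 (D k - \<eta>)" for k
    define s where "s = min 2 (\<alpha> / 4)"
    have s: "0 < s" "s < \<alpha> / 2" "s \<le> 2" using \<alpha> by (auto simp: s_def)
    have pos: "\<eta> * c / (4 * B\<^sup>2 + 1) > 0" using \<eta> c by (intro divide_pos_pos mult_pos_pos add_nonneg_pos) auto
    have half: "\<alpha> / 2 < \<alpha>" "(1 / 2 :: real) > 0" using \<alpha> by simp_all
    have obt: "\<forall>\<^sub>F k in sequentially. p \<bullet> (p - x (Suc k)) < \<eta> / 2"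
      using obtuse[of "\<eta> / 2"] \<eta> by (subst eventually_sequentially_Suc) simp
    have "u \<in> O(\<lambda>k. real k powr - s)"
    proof (rule power_decay_of_recursion)
      show "\<forall>\<^sub>F k in sequentially. u (Suc k) \<le> (1 - (\<alpha> / 2) / real k) * u k + 0 / real k ^ 3"
        using eventually_a_Suc_ge[OF half(1)] eventually_a_Suc_le[OF pos] eventually_a_Suc_le[OF half(2)]
          eventually_a_le_twice B(2) obt
      proof eventually_elim
        case (elim k)
        define b where "b = a (Suc k)"
        have b: "b > 0" "b \<le> 1 / 2" "b \<le> \<eta> * c / (4 * B\<^sup>2 + 1)"
          using elim by (auto simp: b_def a_pos)
        have "(a k)\<^sup>2 * (norm (x k))\<^sup>2 \<le> (2 * b)\<^sup>2 * B\<^sup>2"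
          using elim a_pos[of k] by (intro mult_mono power_mono) (auto simp: b_def)
        also have "\<dots> = b * (b * (4 * B\<^sup>2))" by (simp add: power2_eq_square)
        also have "\<dots> \<le> b * (b * (4 * B\<^sup>2 + 1))" using b by (intro mult_left_mono) auto
        also have "\<dots> \<le> b * (\<eta> * c)"
        proof (intro mult_left_mono)
          have "4 * B\<^sup>2 + 1 > 0" by (intro add_nonneg_pos) auto
          then show "b * (4 * B\<^sup>2 + 1) \<le> \<eta> * c" using b(3) by (simp add: field_simps)
        qed (use b in auto)
        finally have err: "(a k)\<^sup>2 * (norm (x k))\<^sup>2 / c \<le> b * \<eta>" using c by (simp add: field_simps)
        have "x (Suc k) \<bullet> (x (Suc k) - p) = D (Suc k) - p \<bullet> (p - x (Suc k))"
          unfolding D_def power2_norm_eq_inner by (simp add: inner_diff inner_commute)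
        then have "x (Suc k) \<bullet> (x (Suc k) - p) \<ge> D (Suc k) - \<eta> / 2" using elim by simp
        then have "2 * b * (x (Suc k) \<bullet> (x (Suc k) - p)) \<ge> 2 * b * (D (Suc k) - \<eta> / 2)"
          using b by (intro mult_left_mono) auto
        then have contr: "(1 + 2 * b) * (D (Suc k) - \<eta>) \<le> D k - \<eta>"
          using fejer[OF p, of k] err
          unfolding c_def[symmetric] b_def[symmetric] D_def[symmetric] by (simp add: algebra_simps)
        have "(1 + 2 * b) * u (Suc k) \<le> u k"
          using contr by (cases "D (Suc k) \<ge> \<eta>") (auto simp: u_def)
        also have "\<dots> \<le> (1 + 2 * b) * (1 - b) * u k"
        proof -
          have "b * (1 - 2 * b) \<ge> 0" using b by simp
          then have "1 \<le> (1 + 2 * b) * (1 - b)" by (simp add: algebra_simps)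
          then show ?thesis using mult_right_mono[of 1 "(1 + 2 * b) * (1 - b)" "u k"] by (simp add: u_def)
        qed
        finally have "(1 + 2 * b) * u (Suc k) \<le> (1 + 2 * b) * ((1 - b) * u k)" by (simp add: mult.assoc)
        then have "u (Suc k) \<le> (1 - b) * u k" using b by simp
        also have "\<dots> \<le> (1 - (\<alpha> / 2) / real k) * u k"
          using elim(1) by (intro mult_right_mono) (auto simp: b_def u_def)
        finally show ?case by simp
      qed
    qed (use s in \<open>auto simp: u_def\<close>)
    then have "u \<longlonglongrightarrow> 0" using s(1) by (rule power_decay_tendsto_0)
    then have "\<forall>\<^sub>F k in sequentially. u k < \<eta>" using \<eta> by (rule order_tendstoD(2))
    then show ?thesis by eventually_elim (auto simp: u_def \<eta>_def max_def split: if_splits)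
  qed
  then have "D \<longlonglongrightarrow> 0" by (intro tendstoI) (simp add: D_def)
  then have "(\<lambda>k. sqrt (D k)) \<longlonglongrightarrow> sqrt 0" by (rule tendsto_real_sqrt)
  then have "(\<lambda>k. norm (x k - p)) \<longlonglongrightarrow> 0" by (simp add: D_def)
  then show ?thesis by (rule LIM_zero_cancel[OF tendsto_norm_zero_cancel])
qed

lemma converges_to_min_norm_zero:
  obtains p where "is_min_norm_element (zer M) p" "\<And>q. is_min_norm_element (zer M) q \<Longrightarrow> q = p"
    "x \<longlonglongrightarrow> p"
proof -
  obtain z p where z: "\<And>n. M (z n) = - (1 / real (Suc n)) *\<^sub>R z n" "z \<longlonglongrightarrow> p"
    and p: "p \<in> zer M" "\<And>q. q \<in> zer M \<Longrightarrow> p \<bullet> (p - q) \<le> 0"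
    using central_path_limit[OF mono lip zer_nonempty] by blast
  obtain B where "\<forall>\<^sub>F k in sequentially. norm (x k) \<le> B" by (rule eventually_bounded)
  then have "x \<longlonglongrightarrow> p"
    using min_norm_limsup_inner[OF mono z _ operator_tendsto_0] by (intro strong_convergence p) blast
  then show ?thesis using that is_min_norm_elementI_variational[OF p] by blast
qed

end

theorem corollary2p4:
  fixes M :: "'a::{real_inner, complete_space} \<Rightarrow> 'a"
    and L \<theta> \<alpha> \<beta> :: real
    and \<epsilon> :: "nat \<Rightarrow> real"
    and x y :: "nat \<Rightarrow> 'a"
  assumes "L > 0"
    and "monotone_operator M"
    and "L-lipschitz_on UNIV M"
    and "zer M \<noteq> {}"
    and "0 < \<theta>" and "\<theta> < 1 / L"
    and "\<alpha> > 0" and "\<beta> > 0"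
    and "\<And>k. \<epsilon> k = \<alpha> / (\<theta> * (real k + \<beta>))"
    and "\<And>k. y (Suc k) = x k - (\<theta> * \<epsilon> k) *\<^sub>R x k - \<theta> *\<^sub>R M (x k)"
    and "\<And>k. x (Suc k) = x k - (\<theta> * \<epsilon> (Suc k)) *\<^sub>R x (Suc k) - \<theta> *\<^sub>R M (y (Suc k))"
  shows "(\<exists>!p. is_min_norm_element (zer M) p)
    \<and> x \<longlonglongrightarrow> min_norm_element (zer M)
    \<and> (\<alpha> > 1 \<longrightarrow> (\<lambda>k. norm (M (x k))) \<in> O(\<lambda>k. 1 / real k))
    \<and> (\<alpha> \<le> 1 \<longrightarrow> (\<forall>\<delta>. 0 < \<delta> \<and> \<delta> < 1 \<longrightarrow>
          (\<lambda>k. norm (M (x k))) \<in> O(\<lambda>k. real k powr (- (\<alpha> * (1 - \<delta>))))))"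
proof -
  interpret tikhonov_extragradient M L \<theta> \<alpha> \<beta> "\<lambda>k. \<theta> * \<epsilon> k" x y
  proof
    show "\<theta> * L < 1" using \<open>\<theta> < 1 / L\<close> \<open>L > 0\<close> by (simp add: field_simps)
    show "\<theta> * \<epsilon> k = \<alpha> / (real k + \<beta>)" for k using assms(9) \<open>0 < \<theta>\<close> by simp
  qed (fact assms)+
  obtain p where p: "is_min_norm_element (zer M) p"
    "\<And>q. is_min_norm_element (zer M) q \<Longrightarrow> q = p" and lim: "x \<longlonglongrightarrow> p"
    using converges_to_min_norm_zero by blast
  have "min_norm_element (zer M) = p"
    unfolding min_norm_element_def using p by (rule the_equality)
  moreover have "\<exists>!p. is_min_norm_element (zer M) p" using p by (rule ex1I)
  moreover have "(\<lambda>k. norm (M (x k))) \<in> O(\<lambda>k. 1 / real k)" if "\<alpha> > 1"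
    using operator_decay[of 1] that by (simp add: powr_minus divide_inverse)
  moreover have "(\<lambda>k. norm (M (x k))) \<in> O(\<lambda>k. real k powr (- (\<alpha> * (1 - \<delta>))))"
    if "\<alpha> \<le> 1" "0 < \<delta>" "\<delta> < 1" for \<delta>
  proof (rule operator_decay)
    show "\<alpha> * (1 - \<delta>) < \<alpha>" "\<alpha> * (1 - \<delta>) \<le> 1"
      using that \<open>\<alpha> > 0\<close> by (auto intro: mult_le_one)
  qed (use that \<open>\<alpha> > 0\<close> in simp)
  ultimately show ?thesis using lim by blast
qed

end
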